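(* Let $p$ be an odd prime and let $m$ be any positive integer. There exist a finite $p$-group $G$ and a faithful character $\chi\in\operatorname{Irr}(G)$ such that the product $\chi\chi$ has exactly $\frac{p+1}{2}$ distinct irreducible constituents, $\chi$ does not vanish on $G\setminus \mathbf{Z}(G)$ (that is, there is some $g\in G\setminus\mathbf{Z}(G)$ with $\chi(g)\neq 0$), and $\chi(1)=p^m$.
   Context: $\operatorname{Irr}(G)$ denotes the set of irreducible complex characters of the finite group $G$, and $\mathbf{Z}(G)$ is the center of $G$. The product $\chi\chi$ is the pointwise product, a character of $G$; its distinct irreducible constituents are the $\theta\in\operatorname{Irr}(G)$ occurring in it with nonzero multiplicity, each counted once. A character vanishes on a set if it is zero at every element of the set. A character is faithful if its kernel is trivial. *)

theory Defs
  imports "Jordan_Normal_Form.VS_Connect" "HOL-Computational_Algebra.Primes" "HOL-Library.FuncSet"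
begin

definition group_center :: "('a, 'b) monoid_scheme \<Rightarrow> 'a set" where
  "group_center G =
     {z \<in> carrier G. \<forall>g\<in>carrier G. z \<otimes>\<^bsub>G\<^esub> g = g \<otimes>\<^bsub>G\<^esub> z}"

definition finite_p_group :: "nat \<Rightarrow> ('a, 'b) monoid_scheme \<Rightarrow> bool" where
  "finite_p_group p G \<longleftrightarrow> group G \<and> finite (carrier G) \<and> (\<exists>k. Coset.order G = p ^ k)"

definition GL :: "nat \<Rightarrow> complex mat monoid" where
  "GL n = units_of (ring_mat TYPE(complex) n ())"

definition mat_trace :: "'a::comm_monoid_add mat \<Rightarrow> 'a" where
  "mat_trace A = (\<Sum>i<dim_row A. A $$ (i, i))"

text \<open>
  The condition \<open>0 < n\<close> excludes the zero module, which is not irreducible.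
\<close>

definition irreducible_rep ::
  "('a, 'b) monoid_scheme \<Rightarrow> nat \<Rightarrow> ('a \<Rightarrow> complex mat) \<Rightarrow> bool" where
  "irreducible_rep G n \<rho> \<longleftrightarrow>
     \<rho> \<in> hom G (GL n) \<and> 0 < n \<and>
     (\<forall>W. VectorSpace.subspace class_ring W (module_vec TYPE(complex) n) \<longrightarrow>
          (\<forall>g\<in>carrier G. \<forall>w\<in>W. \<rho> g *\<^sub>v w \<in> W) \<longrightarrow>
          W = {0\<^sub>v n} \<or> W = carrier_vec n)"

text \<open>
  Characters are taken as functions with domain \<open>carrier G\<close> (value
  \<open>undefined\<close> elsewhere), so that distinct elements of \<open>Irr G\<close> differ on the group.
\<close>

definition rep_character ::
  "('a, 'b) monoid_scheme \<Rightarrow> ('a \<Rightarrow> complex mat) \<Rightarrow> 'a \<Rightarrow> complex" where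
  "rep_character G \<rho> = (\<lambda>g\<in>carrier G. mat_trace (\<rho> g))"

definition Irr :: "('a, 'b) monoid_scheme \<Rightarrow> ('a \<Rightarrow> complex) set" where
  "Irr G = {rep_character G \<rho> | n \<rho>. irreducible_rep G n \<rho>}"

definition char_kernel :: "('a, 'b) monoid_scheme \<Rightarrow> ('a \<Rightarrow> complex) \<Rightarrow> 'a set" where
  "char_kernel G \<chi> = {g \<in> carrier G. \<chi> g = \<chi> \<one>\<^bsub>G\<^esub>}"

definition faithful_char :: "('a, 'b) monoid_scheme \<Rightarrow> ('a \<Rightarrow> complex) \<Rightarrow> bool" where
  "faithful_char G \<chi> \<longleftrightarrow> char_kernel G \<chi> = {\<one>\<^bsub>G\<^esub>}"

text \<open>
  \<open>m \<eta>\<close> is the multiplicity of \<open>\<eta>\<close> in \<open>\<psi>\<close>. By linear independence of \<open>Irr G\<close> the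
  multiplicities are uniquely determined for \<open>G\<close> finite. The sum runs over the support
  of \<open>m\<close>, so that the definition does not rely on the finiteness of \<open>Irr G\<close>.
\<close>

definition irr_decomposition ::
  "('a, 'b) monoid_scheme \<Rightarrow> ('a \<Rightarrow> complex) \<Rightarrow> (('a \<Rightarrow> complex) \<Rightarrow> nat) \<Rightarrow> bool" where
  "irr_decomposition G \<psi> m \<longleftrightarrow>
     finite {\<eta> \<in> Irr G. m \<eta> \<noteq> 0} \<and>
     (\<forall>g\<in>carrier G. \<psi> g = (\<Sum>\<eta> | \<eta> \<in> Irr G \<and> m \<eta> \<noteq> 0. of_nat (m \<eta>) * \<eta> g))"

definition irr_constituents ::
  "('a, 'b) monoid_scheme \<Rightarrow> ('a \<Rightarrow> complex) \<Rightarrow> ('a \<Rightarrow> complex) set" where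
  "irr_constituents G \<psi> = {\<theta> \<in> Irr G. \<exists>m. irr_decomposition G \<psi> m \<and> m \<theta> \<noteq> 0}"

end

theory Submission
  imports Defs "Jordan_Normal_Form.Spectral_Radius" "HOL-Algebra.Weak_Morphisms"
begin

text \<open>
  Write \<open>N = p ^ m\<close> and \<open>q = p ^ (m - 1)\<close>. The group is a subgroup of the wreath product of the
  \<open>N\<close>-th roots of unity by \<open>\<int>/N\<close>. Its base consists of the functions \<open>f\<close> on \<open>\<int>/N\<close> with values in
  the \<open>N\<close>-th roots of unity such that \<open>f (x + p) = c * f x\<close> for a constant \<open>c\<close> with
  \<open>c ^ q = 1\<close>, and \<open>\<int>/N\<close> acts on the base by translation. Every weight \<open>F f x\<close> that is
  multiplicative in \<open>f\<close> and compatible with translations gives a monomial representation of degree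
  \<open>N\<close> on the functions on \<open>\<int>/N\<close>, in which \<open>(f, s)\<close> sends \<open>w\<close> to \<open>x \<mapsto> F f x * w (x + s)\<close>.
  It is irreducible as soon as some \<open>f\<close> in the base has pairwise distinct weights \<open>F f x\<close>,
  because that diagonal matrix isolates the coordinates and the translations permute them
  transitively (\<open>monomial_rep_irreducible\<close>). The root of unity \<open>\<omega> x = exp (2 \<pi> \<i> x / N)\<close> serves
  as such an \<open>f\<close> for all the weights that occur.

  The character \<open>\<chi>\<close> belongs to the weight \<open>f x\<close>; it is the sum of the values of \<open>f\<close> at \<open>(f, 0)\<close>
  and vanishes at \<open>(f, s)\<close> for \<open>s \<noteq> 0\<close>. Squaring it gives at \<open>(f, 0)\<close> the sum over \<open>k\<close> of
  the pair sums \<open>S k = (\<Sum>x. f x * f (x + k))\<close>, and \<open>S k\<close> is the value at \<open>(f, 0)\<close> of the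
  character with weight \<open>f x * f (x + k)\<close>, which is irreducible because \<open>N\<close> is odd. Now
  \<open>S (- k) = S k\<close>, and \<open>S (k + p) = S k\<close>: the constant \<open>c\<close> would give \<open>S (k + p) = c * S k\<close>, but
  translation by \<open>p\<close> gives \<open>S k = c\<^sup>2 * S k\<close>, and \<open>c\<close> has odd order. So only
  \<open>S 0, \<dots>, S ((p - 1) / 2)\<close> remain (\<open>square_sum_eq_pair_sums\<close>). These \<open>(p + 1) / 2\<close> characters
  are distinct, since a function that is \<open>\<omega> 1\<close> on the residue classes of \<open>0\<close> and \<open>k\<close> modulo \<open>p\<close>
  and \<open>1\<close> elsewhere tells \<open>S k\<close> from every \<open>S l\<close> with \<open>k < l\<close> (\<open>pair_sum_step_distinct\<close>). The role of the
  twist \<open>c\<close> is to make the base rich enough to separate all \<open>N\<close> points while adding no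
  further constituents.

  That there are no other constituents is the uniqueness of multiplicities, which follows from
  the orthogonality of irreducible characters (\<open>character_orthogonality\<close>), proved here by Schur's
  lemma.
\<close>

section \<open>Irreducible matrix representations and Schur's lemma\<close>

lemma subspace_module_vec_iff:
  "VectorSpace.subspace class_ring W (module_vec TYPE(complex) n) \<longleftrightarrow>
     W \<subseteq> carrier_vec n \<and> 0\<^sub>v n \<in> W \<and> (\<forall>v\<in>W. \<forall>w\<in>W. v + w \<in> W) \<and>
     (\<forall>c. \<forall>v\<in>W. c \<cdot>\<^sub>v v \<in> W)"
proof -
  have "vectorspace class_ring (module_vec TYPE(complex) n)"
    by (rule vec_vs)
  moreover have "Module.module class_ring (module_vec TYPE(complex) n)"
    by (rule vec_module)
  ultimately show ?thesis
    by (auto simp: VectorSpace.subspace_def submodule_def module_vec_def)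
qed

lemma subspace_unit_vecs_eq_carrier:
  assumes V: "VectorSpace.subspace class_ring V (module_vec TYPE(complex) n)"
    and u: "\<And>i. i < n \<Longrightarrow> unit_vec n i \<in> V"
  shows "V = carrier_vec n"
proof
  note V' = V[unfolded subspace_module_vec_iff]
  show "V \<subseteq> carrier_vec n" using V' by blast
  show "carrier_vec n \<subseteq> V"
  proof
    fix v :: "complex vec" assume v: "v \<in> carrier_vec n"
    have "vec n (\<lambda>i. if i < k then v $ i else 0) \<in> V" if "k \<le> n" for k
      using that
    proof (induction k)
      case 0
      have "vec n (\<lambda>i. if i < 0 then v $ i else 0) = 0\<^sub>v n" by auto
      then show ?case using V' by simp
    next
      case (Suc k)
      have "vec n (\<lambda>i. if i < Suc k then v $ i else 0) =
          vec n (\<lambda>i. if i < k then v $ i else 0) + v $ k \<cdot>\<^sub>v unit_vec n k"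
        using Suc.prems by (intro eq_vecI) (auto simp: less_Suc_eq)
      then show ?case using V' Suc u[of k] by auto
    qed
    from this[of n] have "vec n (\<lambda>i. if i < n then v $ i else 0) \<in> V" by simp
    moreover have "vec n (\<lambda>i. if i < n then v $ i else 0) = v" using v by auto
    ultimately show "v \<in> V" by simp
  qed
qed

lemma hom_GL_iff:
  assumes "group G"
  shows "\<rho> \<in> hom G (GL n) \<longleftrightarrow>
     (\<forall>g\<in>carrier G. \<rho> g \<in> carrier_mat n n) \<and> \<rho> \<one>\<^bsub>G\<^esub> = 1\<^sub>m n \<and>
     (\<forall>g\<in>carrier G. \<forall>h\<in>carrier G. \<rho> (g \<otimes>\<^bsub>G\<^esub> h) = \<rho> g * \<rho> h)" (is "?L \<longleftrightarrow> ?R")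
proof
  interpret G: group G by fact
  interpret R: ring "ring_mat TYPE(complex) n ()" by (rule ring_mat)
  assume h: ?L
  have "group (GL n)" unfolding GL_def by (rule R.units_group)
  then interpret H: group_hom G "GL n" \<rho>
    using h assms by (simp add: group_hom_def group_hom_axioms_def)
  have "\<rho> \<one>\<^bsub>G\<^esub> = 1\<^sub>m n"
    using H.hom_one by (simp add: GL_def units_of_def ring_mat_def)
  moreover have "\<rho> g \<in> carrier_mat n n" if "g \<in> carrier G" for g
    using H.hom_closed[OF that] by (simp add: GL_def units_of_def Units_def ring_mat_def)
  moreover have "\<rho> (g \<otimes>\<^bsub>G\<^esub> h) = \<rho> g * \<rho> h" if "g \<in> carrier G" "h \<in> carrier G" for g h
    using H.hom_mult[OF that] by (simp add: GL_def units_of_def ring_mat_def)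
  ultimately show ?R by blast
next
  interpret G: group G by fact
  assume R: ?R
  have "\<rho> g \<in> Units (ring_mat TYPE(complex) n ())" if g: "g \<in> carrier G" for g
  proof -
    have "\<rho> (inv\<^bsub>G\<^esub> g) * \<rho> g = 1\<^sub>m n" "\<rho> g * \<rho> (inv\<^bsub>G\<^esub> g) = 1\<^sub>m n"
      using R g by (metis G.inv_closed G.l_inv G.r_inv)+
    then show ?thesis
      using R g by (auto simp: Units_def ring_mat_def intro!: bexI[of _ "\<rho> (inv\<^bsub>G\<^esub> g)"])
  qed
  then show ?L
    using R by (auto simp: hom_def GL_def units_of_def ring_mat_def)
qed

lemma mat_trace_mult_commute:
  fixes A B :: "complex mat"
  assumes "A \<in> carrier_mat n k" "B \<in> carrier_mat k n"
  shows "mat_trace (A * B) = mat_trace (B * A)"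
proof -
  have "mat_trace (A * B) = (\<Sum>i<n. \<Sum>j<k. A $$ (i, j) * B $$ (j, i))"
    using assms by (simp add: mat_trace_def scalar_prod_def atLeast0LessThan)
  also have "\<dots> = (\<Sum>j<k. \<Sum>i<n. B $$ (j, i) * A $$ (i, j))"
    by (subst sum.swap) (simp add: mult.commute)
  also have "\<dots> = mat_trace (B * A)"
    using assms by (simp add: mat_trace_def scalar_prod_def atLeast0LessThan)
  finally show ?thesis .
qed

lemma mult_mat_vec_unit_vec:
  fixes A :: "complex mat"
  assumes "A \<in> carrier_mat k n" "i < n"
  shows "A *\<^sub>v unit_vec n i = col A i"
  using assms by (intro eq_vecI) (auto)

lemma irreducible_repD:
  assumes "group G" "irreducible_rep G n \<rho>"
  shows "0 < n"
    and "g \<in> carrier G \<Longrightarrow> \<rho> g \<in> carrier_mat n n"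
    and "\<rho> \<one>\<^bsub>G\<^esub> = 1\<^sub>m n"
    and "g \<in> carrier G \<Longrightarrow> h \<in> carrier G \<Longrightarrow> \<rho> (g \<otimes>\<^bsub>G\<^esub> h) = \<rho> g * \<rho> h"
    and "\<lbrakk>VectorSpace.subspace class_ring W (module_vec TYPE(complex) n);
          \<And>g w. g \<in> carrier G \<Longrightarrow> w \<in> W \<Longrightarrow> \<rho> g *\<^sub>v w \<in> W\<rbrakk> \<Longrightarrow> W = {0\<^sub>v n} \<or> W = carrier_vec n"
  using assms(2) hom_GL_iff[OF assms(1), of \<rho> n] by (auto simp: irreducible_rep_def)

text \<open>
  The kernel and the image of an intertwining matrix are invariant subspaces, so irreducibility
  leaves only a trivial kernel and a full image.
\<close>

lemma schur_isomorphism: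
  fixes J :: "complex mat"
  assumes G: "group G" and \<rho>: "irreducible_rep G n \<rho>" and \<sigma>: "irreducible_rep G k \<sigma>"
    and J: "J \<in> carrier_mat k n"
    and tw: "\<And>g. g \<in> carrier G \<Longrightarrow> \<sigma> g * J = J * \<rho> g"
    and nz: "J \<noteq> 0\<^sub>m k n"
  shows "\<exists>B \<in> carrier_mat n k. J * B = 1\<^sub>m k \<and> B * J = 1\<^sub>m n"
proof -
  note \<rho>D = irreducible_repD[OF G \<rho>] and \<sigma>D = irreducible_repD[OF G \<sigma>]
  have move: "\<sigma> g *\<^sub>v (J *\<^sub>v v) = J *\<^sub>v (\<rho> g *\<^sub>v v)" if "g \<in> carrier G" "v \<in> carrier_vec n" for g v
    using tw[OF that(1)] J \<rho>D(2)[OF that(1)] \<sigma>D(2)[OF that(1)] that(2)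
    by (metis assoc_mult_mat_vec)
  obtain i where i: "i < n" "J *\<^sub>v unit_vec n i \<noteq> 0\<^sub>v k"
  proof -
    have "\<exists>i<n. col J i \<noteq> 0\<^sub>v k"
    proof (rule ccontr)
      assume "\<not> ?thesis"
      then have "J = 0\<^sub>m k n"
        using J by (intro mat_col_eqI) auto
      with nz show False by simp
    qed
    with that J show thesis by (auto simp: mult_mat_vec_unit_vec)
  qed
  define K where "K = {v \<in> carrier_vec n. J *\<^sub>v v = 0\<^sub>v k}"
  have "K = {0\<^sub>v n} \<or> K = carrier_vec n"
  proof (rule \<rho>D(5))
    show "VectorSpace.subspace class_ring K (module_vec TYPE(complex) n)"
      using J by (auto simp: subspace_module_vec_iff K_def mult_add_distrib_mat_vec mult_mat_vec)
    show "\<rho> g *\<^sub>v w \<in> K" if "g \<in> carrier G" "w \<in> K" for g w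
      using that move[of g w, symmetric] \<rho>D(2)[of g] \<sigma>D(2)[of g]
      by (auto simp: K_def mult_mat_vec_carrier)
  qed
  moreover have "unit_vec n i \<notin> K" using i by (simp add: K_def)
  ultimately have K: "K = {0\<^sub>v n}" by auto
  define I where "I = (*\<^sub>v) J ` carrier_vec n"
  have "I = {0\<^sub>v k} \<or> I = carrier_vec k"
  proof (rule \<sigma>D(5))
    have "J *\<^sub>v v + J *\<^sub>v w \<in> I" if "v \<in> carrier_vec n" "w \<in> carrier_vec n" for v w
      using that J by (auto simp: I_def mult_add_distrib_mat_vec[symmetric])
    moreover have "c \<cdot>\<^sub>v (J *\<^sub>v v) \<in> I" if "v \<in> carrier_vec n" for v c
      using that J by (auto simp: I_def mult_mat_vec[symmetric])
    moreover have "0\<^sub>v k \<in> I"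
      using J by (auto simp: I_def intro!: image_eqI[of _ _ "0\<^sub>v n"])
    ultimately show "VectorSpace.subspace class_ring I (module_vec TYPE(complex) k)"
      using J by (auto simp: subspace_module_vec_iff I_def)
    show "\<sigma> g *\<^sub>v w \<in> I" if "g \<in> carrier G" "w \<in> I" for g w
      using that \<rho>D(2)[of g] by (auto simp: I_def move)
  qed
  moreover have "J *\<^sub>v unit_vec n i \<in> I" by (auto simp: I_def)
  ultimately have I: "I = carrier_vec k" using i by auto
  have "\<exists>v. j < k \<longrightarrow> v \<in> carrier_vec n \<and> J *\<^sub>v v = unit_vec k j" for j
  proof -
    have "j < k \<Longrightarrow> unit_vec k j \<in> I" unfolding I by simp
    then show ?thesis unfolding I_def by force
  qed
  then obtain b where b: "\<And>j. j < k \<Longrightarrow> b j \<in> carrier_vec n \<and> J *\<^sub>v b j = unit_vec k j"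
    by metis
  \<comment> \<open>Preimages of the standard basis are the columns of a right inverse.\<close>
  define B where "B = mat_of_cols n (map b [0..<k])"
  have B: "B \<in> carrier_mat n k" unfolding B_def by (rule mat_of_cols_carrier(1)[of n "map b [0..<k]", simplified])
  have colB: "col B j = b j" if "j < k" for j
    using that b by (simp add: B_def)
  have JB: "J * B = 1\<^sub>m k"
  proof (rule mat_col_eqI)
    fix j assume "j < dim_col (1\<^sub>m k :: complex mat)"
    then have "j < k" by simp
    then show "col (J * B) j = col (1\<^sub>m k) j"
      using b by (simp only: col_mult2[OF J B] colB col_one)
  qed (use J B in auto)
  \<comment> \<open>A right inverse of an injective matrix is also a left inverse, as \<open>J * (B * J) = J\<close>.\<close>
  have "B * J = 1\<^sub>m n"
  proof (rule mat_col_eqI)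
    fix j assume "j < dim_col (1\<^sub>m n :: complex mat)"
    then have j: "j < n" by simp
    let ?d = "B *\<^sub>v col J j - unit_vec n j"
    have Jc: "J *\<^sub>v (B *\<^sub>v col J j) = col J j"
      using J B JB by (metis assoc_mult_mat_vec col_dim carrier_matD(1) one_mult_mat_vec)
    have "J *\<^sub>v ?d = 0\<^sub>v k"
      using Jc J B j by (simp add: mult_minus_distrib_mat_vec[OF J] mult_mat_vec_unit_vec)
    moreover have "?d \<in> carrier_vec n" by (rule carrier_vecI) (simp only: index_minus_vec index_unit_vec)
    ultimately have "?d \<in> K" by (simp add: K_def)
    then have "?d = 0\<^sub>v n" using K by blast
    then have d: "?d $ l = 0" if "l < n" for l using that by (metis index_zero_vec(1))
    have Bc: "dim_vec (B *\<^sub>v col J j) = n" using carrier_matD(1)[OF B] by (simp only: dim_mult_mat_vec)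
    have "B *\<^sub>v col J j = unit_vec n j"
    proof (rule eq_vecI)
      fix l assume "l < dim_vec (unit_vec n j :: complex vec)"
      then have l: "l < n" by (simp only: index_unit_vec)
      have "(B *\<^sub>v col J j) $ l - unit_vec n j $ l = 0"
        using d[OF l] l by (subst (asm) index_minus_vec(1)) simp_all
      then show "(B *\<^sub>v col J j) $ l = unit_vec n j $ l"
        by (rule right_minus_eq[THEN iffD1])
    qed (simp only: Bc index_unit_vec)
    then show "col (B * J) j = col (1\<^sub>m n) j"
      using j by (simp only: col_mult2[OF B J j] col_one)
  qed (use J B in auto)
  with B JB show ?thesis by (intro bexI[of _ B] conjI)
qed

text \<open>
  With \<open>B\<close> the inverse of \<open>J\<close>, \<open>\<sigma> g = J * \<rho> g * B\<close> has the trace of \<open>\<rho> g * B * J = \<rho> g\<close> by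
  the cyclicity of the trace, which holds for rectangular matrices as well.
\<close>

lemma schur_trace_eq:
  fixes J :: "complex mat"
  assumes G: "group G" and \<rho>: "irreducible_rep G n \<rho>" and \<sigma>: "irreducible_rep G k \<sigma>"
    and J: "J \<in> carrier_mat k n"
    and tw: "\<And>g. g \<in> carrier G \<Longrightarrow> \<sigma> g * J = J * \<rho> g"
    and nz: "J \<noteq> 0\<^sub>m k n"
  shows "rep_character G \<sigma> = rep_character G \<rho>"
proof -
  obtain B where B: "B \<in> carrier_mat n k" "J * B = 1\<^sub>m k" "B * J = 1\<^sub>m n"
    using schur_isomorphism[OF assms] by blast
  have "mat_trace (\<sigma> g) = mat_trace (\<rho> g)" if g: "g \<in> carrier G" for g
  proof -
    note cm = irreducible_repD(2)[OF G \<rho> g] irreducible_repD(2)[OF G \<sigma> g]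
    have "\<sigma> g = \<sigma> g * J * B"
      using cm J B by (metis assoc_mult_mat right_mult_one_mat)
    also have "\<dots> = J * (\<rho> g * B)"
      using cm J B tw[OF g] by (metis assoc_mult_mat)
    finally have "mat_trace (\<sigma> g) = mat_trace (\<rho> g * B * J)"
      using cm J B by (metis mat_trace_mult_commute mult_carrier_mat)
    also have "\<rho> g * B * J = \<rho> g"
      using cm J B by (metis assoc_mult_mat right_mult_one_mat)
    finally show ?thesis .
  qed
  then show ?thesis by (auto simp: rep_character_def)
qed

text \<open>
  An eigenvalue \<open>c\<close> of \<open>J\<close> exists over the complex numbers, and \<open>J - c\<close> is an intertwining matrix
  with a nonzero kernel, hence zero.
\<close>

lemma schur_scalar:
  fixes J :: "complex mat"
  assumes G: "group G" and \<rho>: "irreducible_rep G n \<rho>" and J: "J \<in> carrier_mat n n"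
    and tw: "\<And>g. g \<in> carrier G \<Longrightarrow> \<rho> g * J = J * \<rho> g"
  shows "\<exists>c. J = c \<cdot>\<^sub>m 1\<^sub>m n"
proof -
  have "spectrum J \<noteq> {}"
    using spectrum_non_empty[OF J] irreducible_repD(1)[OF G \<rho>] by blast
  then obtain c v where v: "v \<in> carrier_vec n" "v \<noteq> 0\<^sub>v n" "J *\<^sub>v v = c \<cdot>\<^sub>v v"
    using J by (auto simp: spectrum_def eigenvalue_def eigenvector_def)
  define D where "D = J - c \<cdot>\<^sub>m 1\<^sub>m n"
  have D: "D \<in> carrier_mat n n" using J by (auto simp: D_def)
  have smult_mat_mult_vec: "(c \<cdot>\<^sub>m 1\<^sub>m n) *\<^sub>v v = c \<cdot>\<^sub>v v"
    using v by (intro eq_vecI) auto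
  have Dv: "D *\<^sub>v v = 0\<^sub>v n"
    using J v by (simp add: D_def minus_mult_distrib_mat_vec[of _ n n] smult_mat_mult_vec)
  have "D = 0\<^sub>m n n"
  proof (rule ccontr)
    assume "D \<noteq> 0\<^sub>m n n"
    moreover have "\<rho> g * D = D * \<rho> g" if g: "g \<in> carrier G" for g
    proof -
      note cm = irreducible_repD(2)[OF G \<rho> g]
      show ?thesis
        using cm J tw[OF g]
        by (simp add: D_def mult_minus_distrib_mat[of _ n n] minus_mult_distrib_mat[of _ n n]
            mult_smult_distrib[of _ n n _ n] mult_smult_assoc_mat[of _ n n _ n])
    qed
    ultimately obtain B where B: "B \<in> carrier_mat n n" "B * D = 1\<^sub>m n"
      using schur_isomorphism[OF G \<rho> \<rho> D] by blast
    have "v = B *\<^sub>v (D *\<^sub>v v)"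
      using B D v by (metis assoc_mult_mat_vec one_mult_mat_vec)
    also have "\<dots> = 0\<^sub>v n" using B Dv by auto
    finally show False using v by simp
  qed
  have "J = c \<cdot>\<^sub>m 1\<^sub>m n"
  proof (rule eq_matI)
    fix i j assume "i < dim_row (c \<cdot>\<^sub>m 1\<^sub>m n)" "j < dim_col (c \<cdot>\<^sub>m 1\<^sub>m n)"
    then have "i < n" "j < n" by auto
    then show "J $$ (i, j) = (c \<cdot>\<^sub>m 1\<^sub>m n) $$ (i, j)"
      using arg_cong[OF \<open>D = 0\<^sub>m n n\<close>, of "\<lambda>M. M $$ (i, j)"] J by (simp add: D_def)
  qed (use J in auto)
  then show ?thesis by blast
qed

section \<open>Orthogonality of irreducible characters\<close>

text \<open>
  The average, up to the factor \<open>order G\<close>, of \<open>\<sigma> g * E * \<rho> (inv g)\<close>, where \<open>E\<close> is the elementary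
  matrix with entry \<open>1\<close> in position \<open>(a, b)\<close>.
\<close>

definition rep_average ::
  "('a, 'b) monoid_scheme \<Rightarrow> nat \<Rightarrow> ('a \<Rightarrow> complex mat) \<Rightarrow> nat \<Rightarrow> ('a \<Rightarrow> complex mat) \<Rightarrow> nat \<Rightarrow> nat \<Rightarrow> complex mat"
  where "rep_average G k \<sigma> n \<rho> a b =
    mat k n (\<lambda>(i, j). \<Sum>g\<in>carrier G. \<sigma> g $$ (i, a) * \<rho> (inv\<^bsub>G\<^esub> g) $$ (b, j))"

lemma rep_average_intertwines:
  assumes G: "group G" and \<rho>: "irreducible_rep G n \<rho>" and \<sigma>: "irreducible_rep G k \<sigma>"
    and a: "a < k" and b: "b < n" and h: "h \<in> carrier G"
  shows "\<sigma> h * rep_average G k \<sigma> n \<rho> a b = rep_average G k \<sigma> n \<rho> a b * \<rho> h"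
proof (rule eq_matI)
  interpret G: group G by fact
  note \<rho>D = irreducible_repD[OF G \<rho>] and \<sigma>D = irreducible_repD[OF G \<sigma>]
  let ?J = "rep_average G k \<sigma> n \<rho> a b"
  have cm: "\<sigma> h \<in> carrier_mat k k" "\<rho> h \<in> carrier_mat n n" using \<rho>D(2) \<sigma>D(2) h by auto
  fix i j assume "i < dim_row (?J * \<rho> h)" "j < dim_col (?J * \<rho> h)"
  then have i: "i < k" and j: "j < n" using cm by (auto simp: rep_average_def)
  have entry\<sigma>: "(\<Sum>l<k. \<sigma> h $$ (i, l) * \<sigma> g $$ (l, a)) = \<sigma> (h \<otimes>\<^bsub>G\<^esub> g) $$ (i, a)"
    if g: "g \<in> carrier G" for g
    using \<sigma>D(2)[OF g] \<sigma>D(4)[OF h g] cm i a by (simp add: scalar_prod_def atLeast0LessThan)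
  have entry\<rho>: "(\<Sum>l<n. \<rho> g $$ (b, l) * \<rho> h $$ (l, j)) = \<rho> (g \<otimes>\<^bsub>G\<^esub> h) $$ (b, j)"
    if g: "g \<in> carrier G" for g
    using \<rho>D(2)[OF g] \<rho>D(4)[OF g h] cm j b by (simp add: scalar_prod_def atLeast0LessThan)
  have "(\<sigma> h * ?J) $$ (i, j) =
      (\<Sum>l<k. \<Sum>g\<in>carrier G. \<sigma> h $$ (i, l) * (\<sigma> g $$ (l, a) * \<rho> (inv\<^bsub>G\<^esub> g) $$ (b, j)))"
    using cm i j by (simp add: rep_average_def scalar_prod_def atLeast0LessThan sum_distrib_left)
  also have "\<dots> = (\<Sum>g\<in>carrier G. \<sigma> (h \<otimes>\<^bsub>G\<^esub> g) $$ (i, a) * \<rho> (inv\<^bsub>G\<^esub> g) $$ (b, j))"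
    by (subst sum.swap) (simp add: entry\<sigma>[symmetric] sum_distrib_right mult.assoc)
  \<comment> \<open>Substitute \<open>inv h \<otimes> g\<close> for \<open>g\<close>.\<close>
  also have "\<dots> = (\<Sum>g\<in>carrier G. \<sigma> g $$ (i, a) * \<rho> (inv\<^bsub>G\<^esub> g \<otimes>\<^bsub>G\<^esub> h) $$ (b, j))"
    by (rule sum.reindex_bij_witness[of _ "\<lambda>g. inv\<^bsub>G\<^esub> h \<otimes>\<^bsub>G\<^esub> g" "\<lambda>g. h \<otimes>\<^bsub>G\<^esub> g"])
       (use h in \<open>auto simp: G.m_assoc[symmetric] G.inv_mult_group\<close>, simp add: G.m_assoc)
  also have "\<dots> = (\<Sum>l<n. \<Sum>g\<in>carrier G. \<sigma> g $$ (i, a) * \<rho> (inv\<^bsub>G\<^esub> g) $$ (b, l) * \<rho> h $$ (l, j))"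
    by (subst sum.swap) (simp add: entry\<rho>[symmetric] sum_distrib_left mult.assoc)
  also have "\<dots> = (?J * \<rho> h) $$ (i, j)"
    using cm i j by (simp add: rep_average_def scalar_prod_def atLeast0LessThan sum_distrib_right)
  finally show "(\<sigma> h * ?J) $$ (i, j) = (?J * \<rho> h) $$ (i, j)" .
qed (use irreducible_repD(2)[OF G \<rho> h] irreducible_repD(2)[OF G \<sigma> h] in \<open>auto simp: rep_average_def\<close>)

lemma sum_rep_characters_eq_average:
  assumes G: "group G" and \<rho>: "irreducible_rep G n \<rho>" and \<sigma>: "irreducible_rep G k \<sigma>"
  shows "(\<Sum>g\<in>carrier G. rep_character G \<sigma> g * rep_character G \<rho> (inv\<^bsub>G\<^esub> g)) =
    (\<Sum>i<k. \<Sum>j<n. rep_average G k \<sigma> n \<rho> i j $$ (i, j))"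
proof -
  interpret G: group G by fact
  have "(\<Sum>g\<in>carrier G. rep_character G \<sigma> g * rep_character G \<rho> (inv\<^bsub>G\<^esub> g)) =
      (\<Sum>g\<in>carrier G. \<Sum>i<k. \<Sum>j<n. \<sigma> g $$ (i, i) * \<rho> (inv\<^bsub>G\<^esub> g) $$ (j, j))"
    using carrier_matD[OF irreducible_repD(2)[OF G \<rho>]] carrier_matD[OF irreducible_repD(2)[OF G \<sigma>]]
    by (intro sum.cong) (auto simp: rep_character_def mat_trace_def sum_product)
  also have "\<dots> = (\<Sum>i<k. \<Sum>g\<in>carrier G. \<Sum>j<n. \<sigma> g $$ (i, i) * \<rho> (inv\<^bsub>G\<^esub> g) $$ (j, j))"
    by (rule sum.swap)
  also have "\<dots> = (\<Sum>i<k. \<Sum>j<n. \<Sum>g\<in>carrier G. \<sigma> g $$ (i, i) * \<rho> (inv\<^bsub>G\<^esub> g) $$ (j, j))"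
    by (intro sum.cong refl sum.swap)
  finally show ?thesis by (simp add: rep_average_def)
qed

text \<open>
  By Schur's lemma every averaged elementary matrix is zero if the characters differ, and scalar
  if the two representations coincide; in the second case its trace determines the scalar.
\<close>

theorem character_orthogonality:
  assumes G: "group G" and fin: "finite (carrier G)" and \<chi>: "\<chi> \<in> Irr G" and \<psi>: "\<psi> \<in> Irr G"
  shows "(\<Sum>g\<in>carrier G. \<chi> g * \<psi> (inv\<^bsub>G\<^esub> g)) = (if \<chi> = \<psi> then of_nat (Coset.order G) else 0)"
proof -
  interpret G: group G by fact
  obtain n \<rho> k \<sigma> where \<rho>: "irreducible_rep G n \<rho>" "\<psi> = rep_character G \<rho>"
    and \<sigma>: "irreducible_rep G k \<sigma>" "\<chi> = rep_character G \<sigma>"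
    using \<chi> \<psi> by (auto simp: Irr_def)
  show ?thesis
  proof (cases "\<chi> = \<psi>")
    case False
    have "rep_average G k \<sigma> n \<rho> i j = 0\<^sub>m k n" if "i < k" "j < n" for i j
    proof (rule ccontr)
      assume "rep_average G k \<sigma> n \<rho> i j \<noteq> 0\<^sub>m k n"
      from schur_trace_eq[OF G \<rho>(1) \<sigma>(1) _ rep_average_intertwines[OF G \<rho>(1) \<sigma>(1) that] this]
      show False using False \<rho> \<sigma> by (simp add: rep_average_def)
    qed
    then show ?thesis
      using False sum_rep_characters_eq_average[OF G \<rho>(1) \<sigma>(1)] \<rho>(2) \<sigma>(2) by simp
  next
    case True
    note \<rho>D = irreducible_repD[OF G \<rho>(1)]
    let ?J = "rep_average G n \<rho> n \<rho>"
    have "?J i j $$ (i, j) = (if i = j then of_nat (Coset.order G) / of_nat n else 0)"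
      if ij: "i < n" "j < n" for i j
    proof -
      obtain c where c: "?J i j = c \<cdot>\<^sub>m 1\<^sub>m n"
        using schur_scalar[OF G \<rho>(1) _ rep_average_intertwines[OF G \<rho>(1) \<rho>(1) ij, symmetric, THEN sym]]
        by (auto simp: rep_average_def)
      have "of_nat n * c = mat_trace (?J i j)"
        unfolding c by (simp add: mat_trace_def)
      also have "\<dots> = (\<Sum>g\<in>carrier G. \<Sum>l<n. \<rho> (inv\<^bsub>G\<^esub> g) $$ (j, l) * \<rho> g $$ (l, i))"
        by (subst sum.swap) (simp add: mat_trace_def rep_average_def mult.commute)
      also have "\<dots> = (\<Sum>g\<in>carrier G. (\<rho> (inv\<^bsub>G\<^esub> g) * \<rho> g) $$ (j, i))"
        using carrier_matD[OF \<rho>D(2)] ij by (intro sum.cong) (auto simp: scalar_prod_def atLeast0LessThan)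
      also have "\<dots> = (\<Sum>g\<in>carrier G. if i = j then 1 else 0)"
        using ij \<rho>D(3) by (intro sum.cong) (auto simp: \<rho>D(4)[symmetric])
      also have "\<dots> = (if i = j then of_nat (Coset.order G) else 0)"
        by (simp add: Coset.order_def)
      finally have "of_nat n * c = (if i = j then of_nat (Coset.order G) else 0)" .
      then have "c = (if i = j then of_nat (Coset.order G) / of_nat n else 0)"
        using \<rho>D(1) by (auto simp: field_simps)
      then show ?thesis using c ij by auto
    qed
    then have "(\<Sum>i<n. \<Sum>j<n. ?J i j $$ (i, j)) = of_nat (Coset.order G)"
      using \<rho>D(1) by simp
    then show ?thesis
      using True sum_rep_characters_eq_average[OF G \<rho>(1) \<rho>(1)] \<rho>(2) by simp
  qed
qed

text \<open>
  The multiplicities are the inner products with the irreducible characters, so \<open>\<psi>\<close> determines them.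
\<close>

lemma irr_decomposition_multiplicity:
  assumes G: "group G" and fin: "finite (carrier G)"
    and dec: "irr_decomposition G \<psi> m" and \<theta>: "\<theta> \<in> Irr G"
  shows "(\<Sum>g\<in>carrier G. \<psi> g * \<theta> (inv\<^bsub>G\<^esub> g)) = of_nat (m \<theta> * Coset.order G)"
proof -
  interpret G: group G by fact
  let ?S = "{\<eta> \<in> Irr G. m \<eta> \<noteq> 0}"
  have S: "finite ?S" and \<psi>: "\<And>g. g \<in> carrier G \<Longrightarrow> \<psi> g = (\<Sum>\<eta>\<in>?S. of_nat (m \<eta>) * \<eta> g)"
    using dec by (auto simp: irr_decomposition_def)
  have "(\<Sum>g\<in>carrier G. \<psi> g * \<theta> (inv\<^bsub>G\<^esub> g)) =
      (\<Sum>g\<in>carrier G. \<Sum>\<eta>\<in>?S. of_nat (m \<eta>) * (\<eta> g * \<theta> (inv\<^bsub>G\<^esub> g)))"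
    by (intro sum.cong) (simp_all add: \<psi> sum_distrib_right mult.assoc)
  also have "\<dots> = (\<Sum>\<eta>\<in>?S. of_nat (m \<eta>) * (\<Sum>g\<in>carrier G. \<eta> g * \<theta> (inv\<^bsub>G\<^esub> g)))"
    by (subst sum.swap) (simp add: sum_distrib_left)
  also have "\<dots> = (\<Sum>\<eta>\<in>?S. if \<eta> = \<theta> then of_nat (m \<theta> * Coset.order G) else 0)"
    using \<theta> by (intro sum.cong) (auto simp: character_orthogonality[OF G fin])
  also have "\<dots> = of_nat (m \<theta> * Coset.order G)"
    using S \<theta> by (auto simp: sum.delta)
  finally show ?thesis .
qed

theorem irr_constituents_eq_support:
  assumes G: "group G" and fin: "finite (carrier G)" and dec: "irr_decomposition G \<psi> m"
  shows "irr_constituents G \<psi> = {\<theta> \<in> Irr G. m \<theta> \<noteq> 0}"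
proof -
  interpret G: group G by fact
  have "Coset.order G > 0" using fin by (simp add: G.order_gt_0_iff_finite)
  have uniq: "m' \<theta> = m \<theta>" if "irr_decomposition G \<psi> m'" "\<theta> \<in> Irr G" for m' \<theta>
  proof -
    have "(of_nat (m' \<theta> * Coset.order G) :: complex) = of_nat (m \<theta> * Coset.order G)"
      using irr_decomposition_multiplicity[OF G fin that] irr_decomposition_multiplicity[OF G fin dec that(2)]
      by metis
    then have "m' \<theta> * Coset.order G = m \<theta> * Coset.order G" by (simp only: of_nat_eq_iff)
    with \<open>Coset.order G > 0\<close> show ?thesis by simp
  qed
  have "(\<exists>m'. irr_decomposition G \<psi> m' \<and> m' \<theta> \<noteq> 0) \<longleftrightarrow> m \<theta> \<noteq> 0" if "\<theta> \<in> Irr G" for \<theta>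
    using uniq[OF _ that] dec by metis
  then show ?thesis unfolding irr_constituents_def by blast
qed

corollary card_irr_constituents:
  fixes c :: "'i \<Rightarrow> nat"
  assumes G: "group G" and fin: "finite (carrier G)" and I: "finite I"
    and irr: "\<And>i. i \<in> I \<Longrightarrow> X i \<in> Irr G" and inj: "inj_on X I"
    and c: "\<And>i. i \<in> I \<Longrightarrow> c i \<noteq> 0"
    and \<psi>: "\<And>g. g \<in> carrier G \<Longrightarrow> \<psi> g = (\<Sum>i\<in>I. of_nat (c i) * X i g)"
  shows "card (irr_constituents G \<psi>) = card I"
proof -
  define m where "m \<eta> = (if \<eta> \<in> X ` I then c (inv_into I X \<eta>) else 0)" for \<eta>
  have m: "m (X i) = c i" if "i \<in> I" for i
    using that inj by (simp add: m_def)
  have supp: "{\<eta> \<in> Irr G. m \<eta> \<noteq> 0} = X ` I"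
    using irr c by (auto simp: m) (auto simp: m_def split: if_splits)
  have "irr_decomposition G \<psi> m"
    unfolding irr_decomposition_def supp using I inj by (auto simp: \<psi> sum.reindex m)
  then show ?thesis
    using irr_constituents_eq_support[OF G fin] supp inj by (simp add: card_image)
qed


section \<open>Transport along isomorphisms\<close>

lemma irreducible_rep_pullback:
  assumes G: "group G" and H: "group H" and h: "h \<in> iso G H" and \<rho>: "irreducible_rep H n \<rho>"
  shows "irreducible_rep G n (\<rho> \<circ> h)"
proof -
  have hom: "h \<in> hom G H" and im: "h ` carrier G = carrier H"
    using h by (auto simp: iso_def bij_betw_def)
  have "\<rho> \<circ> h \<in> hom G (GL n)"
    using hom_compose[OF hom] \<rho>[unfolded irreducible_rep_def, THEN conjunct1] .
  moreover have "W = {0\<^sub>v n} \<or> W = carrier_vec n"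
    if W: "VectorSpace.subspace class_ring W (module_vec TYPE(complex) n)"
      and inv: "\<forall>g\<in>carrier G. \<forall>w\<in>W. (\<rho> \<circ> h) g *\<^sub>v w \<in> W" for W
  proof (rule irreducible_repD(5)[OF H \<rho> W])
    fix g w assume "g \<in> carrier H" "w \<in> W"
    then obtain g' where "g' \<in> carrier G" "g = h g'" using im by blast
    with inv \<open>w \<in> W\<close> show "\<rho> g *\<^sub>v w \<in> W" by simp
  qed
  ultimately show ?thesis
    using irreducible_repD(1)[OF H \<rho>] by (simp add: irreducible_rep_def)
qed

lemma finite_group_iso_nat:
  assumes G: "group G" and fin: "finite (carrier G)"
  shows "\<exists>(H :: nat monoid) h. group H \<and> h \<in> iso H G"
proof -
  interpret G: group G by fact
  obtain e :: "'a \<Rightarrow> nat" where e: "inj_on e (carrier G)"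
    using finite_imp_inj_to_nat_seg[OF fin] by blast
  let ?H = "image_group e G"
  have iso: "e \<in> iso G ?H"
    using e by (auto simp: iso_def hom_def image_group_def bij_betw_def)
  have "group ?H"
    using G.iso_imp_img_group[OF iso] by (simp add: image_group_def)
  with G.iso_set_sym[OF iso] show ?thesis by blast
qed

section \<open>Sums over residues\<close>

lemma sum_nat_int: "(\<Sum>i<n. h (int i)) = (\<Sum>x\<in>{0..<int n}. h x)"
  by (rule sum.reindex_bij_witness[of _ nat int]) auto

lemma sum_shift_periodic:
  fixes h :: "int \<Rightarrow> complex"
  assumes per: "\<And>x. h (x mod int N) = h x" and N: "N > 0"
  shows "(\<Sum>x\<in>{0..<int N}. h (x + t)) = (\<Sum>x\<in>{0..<int N}. h x)"
proof (rule sum.reindex_bij_witness[of _ "\<lambda>x. (x - t) mod int N" "\<lambda>x. (x + t) mod int N"])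
  fix x assume "x \<in> {0..<int N}"
  then show "((x + t) mod int N - t) mod int N = x" "((x - t) mod int N + t) mod int N = x"
    by (simp_all add: mod_simps)
  show "h ((x + t) mod int N) = h (x + t)" by (rule per)
qed (use N in auto)

section \<open>The twisted wreath product\<close>

locale odd_prime_power =
  fixes p m :: nat
  assumes prime_p: "prime p" and odd_p: "odd p" and m_pos: "m \<ge> 1"
begin

definition q :: nat where "q = p ^ (m - 1)"
definition N :: nat where "N = p ^ m"

lemma p_gt_2: "p > 2"
  using prime_p odd_p by (metis prime_gt_1_nat One_nat_def Suc_lessI even_numeral numeral_2_eq_2)

lemma N_eq: "N = p * q"
  using m_pos by (simp add: N_def q_def power_eq_if)

lemma q_pos: "q > 0" and N_pos: "N > 0" and odd_q: "odd q" and odd_N: "odd N"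
  using p_gt_2 odd_p by (auto simp: q_def N_def)

text \<open>
  Functions on \<open>\<int>/N\<close> are taken as functions on all integers: the twisted period \<open>p\<close> makes them
  \<open>N\<close>-periodic (\<open>base_mod\<close>), because \<open>N = p * q\<close> and \<open>c ^ q = 1\<close>.
\<close>

definition base :: "(int \<Rightarrow> complex) set" where
  "base = {f. (\<forall>x. f x ^ N = 1) \<and> (\<exists>c. c ^ q = 1 \<and> (\<forall>x. f (x + int p) = c * f x))}"

lemma baseI:
  assumes "\<And>x. f x ^ N = 1" "c ^ q = 1" "\<And>x. f (x + int p) = c * f x"
  shows "f \<in> base"
  using assms by (auto simp: base_def)

lemma base_nonzero: "f \<in> base \<Longrightarrow> f x \<noteq> 0"
  using N_pos by (auto simp: base_def) (metis power_0_left zero_neq_one not_gr_zero)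

lemma base_one: "(\<lambda>x. 1) \<in> base"
  by (rule baseI[where c = 1]) auto

lemma base_mult_shift:
  assumes "f \<in> base" "g \<in> base"
  shows "(\<lambda>x. f x * g (x + s)) \<in> base"
proof -
  obtain c d where "c ^ q = 1" "\<And>x. f (x + int p) = c * f x" "d ^ q = 1" "\<And>x. g (x + int p) = d * g x"
    using assms by (auto simp: base_def)
  moreover have "g (x + int p + s) = g ((x + s) + int p)" for x by (simp add: algebra_simps)
  ultimately show ?thesis
    using assms by (intro baseI[where c = "c * d"]) (auto simp: base_def power_mult_distrib)
qed

lemma base_inverse_shift:
  assumes "f \<in> base"
  shows "(\<lambda>x. inverse (f (x + s))) \<in> base"
proof -
  obtain c where "c ^ q = 1" "\<And>x. f (x + int p) = c * f x"
    using assms by (auto simp: base_def)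
  moreover have "f (x + int p + s) = f ((x + s) + int p)" for x by (simp add: algebra_simps)
  ultimately show ?thesis
    using assms by (intro baseI[where c = "inverse c"]) (auto simp: base_def power_inverse)
qed

lemma twisted_period_multiple:
  fixes c :: complex
  assumes "\<And>x. f (x + int p) = c * f x" and "c \<noteq> 0"
  shows "f (x + int p * j) = c powi j * f x"
proof (induction j rule: int_induct[of _ 0])
  case base
  show ?case by simp
next
  case (step1 i)
  have "f (x + int p * (i + 1)) = f ((x + int p * i) + int p)" by (simp add: algebra_simps)
  then show ?case using step1 assms by (simp add: power_int_add)
next
  case (step2 i)
  have "f ((x + int p * (i - 1)) + int p) = f (x + int p * i)" by (simp add: algebra_simps)
  then have "c * f (x + int p * (i - 1)) = c powi i * f x" using step2 assms by simp
  then show ?case using assms(2) by (simp add: power_int_diff field_simps)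
qed

lemma base_mod:
  assumes "f \<in> base"
  shows "f (x mod int N) = f x"
proof -
  obtain c where c: "c ^ q = 1" "\<And>x. f (x + int p) = c * f x"
    using assms by (auto simp: base_def)
  have "c \<noteq> 0" using c q_pos by (metis power_0_left zero_neq_one not_gr_zero)
  define j where "j = x div int N"
  have "x = x mod int N + int p * (int q * j)"
    using mod_mult_div_eq[of x "int N"] by (simp add: j_def N_eq mult.assoc)
  then have "f x = c powi (int q * j) * f (x mod int N)"
    using twisted_period_multiple[where f = f, OF c(2) \<open>c \<noteq> 0\<close>] by metis
  also have "c powi (int q * j) = 1"
    using c by (simp add: power_int_mult)
  finally show ?thesis by simp
qed

lemma base_cong: "f \<in> base \<Longrightarrow> x mod int N = y mod int N \<Longrightarrow> f x = f y"
  by (metis base_mod)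

text \<open>
  The semidirect product of the base by the translations, which are given by their
  representatives in \<open>{0..<N}\<close>.
\<close>

definition wreath :: "((int \<Rightarrow> complex) \<times> int) monoid" where
  "wreath = \<lparr>carrier = base \<times> {0..<int N},
        monoid.mult = (\<lambda>(f, s) (g, t). (\<lambda>x. f x * g (x + s), (s + t) mod int N)),
        monoid.one = (\<lambda>x. 1, 0)\<rparr>"

lemma carrier_wreath: "carrier wreath = base \<times> {0..<int N}"
  and one_wreath: "\<one>\<^bsub>wreath\<^esub> = (\<lambda>x. 1, 0)"
  and mult_wreath: "(f, s) \<otimes>\<^bsub>wreath\<^esub> (g, t) = (\<lambda>x. f x * g (x + s), (s + t) mod int N)"
  by (simp_all add: wreath_def)

lemma group_wreath: "group wreath"
proof (rule groupI)
  show "\<one>\<^bsub>wreath\<^esub> \<in> carrier wreath" using N_pos by (simp add: carrier_wreath one_wreath base_one)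
  fix a assume a: "a \<in> carrier wreath"
  show "\<one>\<^bsub>wreath\<^esub> \<otimes>\<^bsub>wreath\<^esub> a = a" using a by (auto simp: carrier_wreath one_wreath mult_wreath)
  show "\<exists>b\<in>carrier wreath. b \<otimes>\<^bsub>wreath\<^esub> a = \<one>\<^bsub>wreath\<^esub>"
  proof (cases a)
    case (Pair f s)
    have f: "f \<in> base" using a Pair by (simp add: carrier_wreath)
    have "f (x + - s mod int N) = f (x - s)" for x
      by (rule base_cong[OF f]) (simp add: mod_simps)
    then have "((\<lambda>x. inverse (f (x + - s))), (- s) mod int N) \<otimes>\<^bsub>wreath\<^esub> a = \<one>\<^bsub>wreath\<^esub>"
      using Pair base_nonzero[OF f] by (simp add: mult_wreath one_wreath mod_simps)
    moreover have "((\<lambda>x. inverse (f (x + - s))), (- s) mod int N) \<in> carrier wreath"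
      using base_inverse_shift[OF f, of "- s"] N_pos by (simp add: carrier_wreath)
    ultimately show ?thesis by blast
  qed
  fix b assume b: "b \<in> carrier wreath"
  show "a \<otimes>\<^bsub>wreath\<^esub> b \<in> carrier wreath"
    using a b N_pos by (auto simp: carrier_wreath mult_wreath base_mult_shift)
  fix c assume c: "c \<in> carrier wreath"
  obtain f s g t h u where eq: "a = (f, s)" "b = (g, t)" "c = (h, u)" by (metis surj_pair)
  have h: "h \<in> base" using c eq by (simp add: carrier_wreath)
  have "h (x + (s + t) mod int N) = h (x + s + t)" for x
    by (rule base_cong[OF h]) (simp add: mod_simps add.assoc)
  then show "a \<otimes>\<^bsub>wreath\<^esub> b \<otimes>\<^bsub>wreath\<^esub> c = a \<otimes>\<^bsub>wreath\<^esub> (b \<otimes>\<^bsub>wreath\<^esub> c)"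
    by (simp add: eq mult_wreath mod_simps add.assoc mult.assoc)
qed

text \<open>
  A function in the base amounts to its twist \<open>c\<close> and to arbitrary values on \<open>{0..<p}\<close>; this is
  what makes the order of the group a power of \<open>p\<close>.
\<close>

definition base_code :: "(int \<Rightarrow> complex) \<Rightarrow> complex \<times> (int \<Rightarrow> complex)" where
  "base_code f = (f (int p) / f 0, restrict f {0..<int p})"

lemma base_twist:
  assumes "f \<in> base"
  shows "(f (int p) / f 0) ^ q = 1" and "f (x + int p) = (f (int p) / f 0) * f x"
proof -
  obtain c where c: "c ^ q = 1" "\<And>x. f (x + int p) = c * f x"
    using assms by (auto simp: base_def)
  have "f (int p) / f 0 = c"
    using c(2)[of 0] base_nonzero[OF assms, of 0] by simp
  then show "(f (int p) / f 0) ^ q = 1" and "f (x + int p) = (f (int p) / f 0) * f x"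
    using c by auto
qed

lemma bij_betw_base_code:
  "bij_betw base_code base ({c. c ^ q = 1} \<times> ({0..<int p} \<rightarrow>\<^sub>E {z. z ^ N = 1}))"
proof (rule bij_betwI[where g = "\<lambda>(c, g) x. c powi (x div int p) * g (x mod int p)"])
  show "base_code \<in> base \<rightarrow> {c. c ^ q = 1} \<times> ({0..<int p} \<rightarrow>\<^sub>E {z. z ^ N = 1})"
    using base_twist(1) by (auto simp: base_code_def) (auto simp: base_def)
  show "(\<lambda>(c, g) x. c powi (x div int p) * g (x mod int p)) \<in>
      {c. c ^ q = 1} \<times> ({0..<int p} \<rightarrow>\<^sub>E {z. z ^ N = 1}) \<rightarrow> base"
  proof clarify
    fix c :: complex and g assume c: "c ^ q = 1" and g: "g \<in> {0..<int p} \<rightarrow>\<^sub>E {z :: complex. z ^ N = 1}"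
    have c0: "c \<noteq> 0" using c q_pos by (metis power_0_left zero_neq_one not_gr_zero)
    show "(\<lambda>x. c powi (x div int p) * g (x mod int p)) \<in> base"
    proof (rule baseI[OF _ c])
      fix x
      have "x mod int p \<in> {0..<int p}" using p_gt_2 by simp
      then have "g (x mod int p) ^ N = 1" using g by (auto simp: PiE_def Pi_def)
      moreover have "(c powi (x div int p)) ^ N = 1"
      proof -
        have "(c powi (x div int p)) ^ N = (c ^ N) powi (x div int p)"
          by (simp add: power_int_power power_int_power' mult.commute)
        also have "c ^ N = 1" using c by (simp add: N_eq mult.commute[of p] power_mult)
        finally show ?thesis by simp
      qed
      ultimately show "(c powi (x div int p) * g (x mod int p)) ^ N = 1"
        by (simp add: power_mult_distrib)
      show "c powi ((x + int p) div int p) * g ((x + int p) mod int p) =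
          c * (c powi (x div int p) * g (x mod int p))"
        using p_gt_2 c0 by (simp add: power_int_add)
    qed
  qed
  show "(\<lambda>(c, g) x. c powi (x div int p) * g (x mod int p)) (base_code f) = f" if f: "f \<in> base" for f
  proof
    fix x
    have "f (int p) / f 0 \<noteq> 0" using base_nonzero[OF f] by simp
    from twisted_period_multiple[where f = f, OF base_twist(2)[OF f] this, of "x mod int p" "x div int p"]
    show "(\<lambda>(c, g) x. c powi (x div int p) * g (x mod int p)) (base_code f) x = f x"
      using p_gt_2 by (simp add: base_code_def)
  qed
  show "base_code ((\<lambda>(c, g) x. c powi (x div int p) * g (x mod int p)) cg) = cg"
    if cg: "cg \<in> {c. c ^ q = 1} \<times> ({0..<int p} \<rightarrow>\<^sub>E {z. z ^ N = 1})" for cg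
  proof (cases cg)
    case (Pair c g)
    have g: "g \<in> {0..<int p} \<rightarrow>\<^sub>E {z. z ^ N = 1}" using cg Pair by simp
    have "g 0 ^ N = 1" using g p_gt_2 by (auto simp: PiE_def Pi_def)
    then have "g 0 \<noteq> 0" using N_pos by (metis power_0_left zero_neq_one not_gr_zero)
    moreover have "restrict (\<lambda>x. c powi (x div int p) * g (x mod int p)) {0..<int p} = g"
    proof
      fix x show "restrict (\<lambda>x. c powi (x div int p) * g (x mod int p)) {0..<int p} x = g x"
        using g by (auto simp: PiE_def extensional_def)
    qed
    ultimately show ?thesis using p_gt_2 Pair by (simp add: base_code_def)
  qed
qed

lemma card_base: "card base = q * N ^ p" and finite_base: "finite base"
proof -
  let ?C = "{c::complex. c ^ q = 1} \<times> ({0..<int p} \<rightarrow>\<^sub>E {z :: complex. z ^ N = 1})"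
  have "finite ?C"
    using q_pos N_pos by (intro finite_cartesian_product finite_PiE finite_roots_unity) auto
  then show "finite base" using bij_betw_finite[OF bij_betw_base_code] by simp
  show "card base = q * N ^ p"
    using bij_betw_same_card[OF bij_betw_base_code] q_pos N_pos
    by (simp add: card_cartesian_product card_PiE card_roots_unity_eq)
qed

lemma finite_wreath: "finite (carrier wreath)"
  using finite_base by (simp add: carrier_wreath)

lemma order_wreath: "\<exists>k. Coset.order wreath = p ^ k"
proof -
  have "Coset.order wreath = p ^ (m - 1) * (p ^ m) ^ p * p ^ m"
    by (simp add: Coset.order_def carrier_wreath card_cartesian_product card_base del: of_nat_power)
       (simp add: q_def N_def)
  also have "\<dots> = p ^ (m - 1 + m * p + m)"
    by (simp only: power_add power_mult)
  finally show ?thesis by blast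
qed

section \<open>Monomial representations\<close>

definition \<omega> :: "int \<Rightarrow> complex" where
  "\<omega> x = cis (2 * pi * of_int x / of_nat N)"

lemma \<omega>_add: "\<omega> (x + y) = \<omega> x * \<omega> y"
  by (simp add: \<omega>_def cis_mult add_divide_distrib distrib_left)

lemma \<omega>_power: "\<omega> x ^ k = \<omega> (int k * x)"
  by (induction k) (simp_all add: \<omega>_add algebra_simps, simp add: \<omega>_def)

lemma \<omega>_eq_1_iff: "\<omega> x = 1 \<longleftrightarrow> int N dvd x"
proof
  assume "\<omega> x = 1"
  then have "cos (2 * pi * of_int x / of_nat N) = 1"
    by (simp add: \<omega>_def complex_eq_iff)
  then obtain k :: int where "2 * pi * of_int x / of_nat N = of_int k * 2 * pi"
    by (auto simp: cos_one_2pi_int)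
  then have "real_of_int x = real_of_int (k * int N)"
    using N_pos by (simp add: field_simps)
  then have "x = k * int N" by (simp only: of_int_eq_iff)
  then show "int N dvd x" by simp
next
  assume "int N dvd x"
  then obtain k where "x = int N * k" by blast
  then have "2 * pi * of_int x / of_nat N = 2 * pi * of_int k"
    using N_pos by simp
  then show "\<omega> x = 1" by (simp add: \<omega>_def)
qed

lemma \<omega>_eq_iff: "\<omega> x = \<omega> y \<longleftrightarrow> int N dvd x - y"
proof -
  have "\<omega> x = \<omega> (x - y) * \<omega> y" by (simp flip: \<omega>_add)
  moreover have "\<omega> y \<noteq> 0" by (simp add: \<omega>_def)
  ultimately show ?thesis by (simp flip: \<omega>_eq_1_iff)
qed

lemma \<omega>_base: "\<omega> \<in> base"
proof (rule baseI[where c = "\<omega> (int p)"])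
  show "\<omega> x ^ N = 1" for x by (simp add: \<omega>_power \<omega>_eq_1_iff)
  show "\<omega> (int p) ^ q = 1" by (simp add: \<omega>_power \<omega>_eq_1_iff N_eq)
qed (simp add: \<omega>_add)

text \<open>
  Coordinates of vectors are the values of functions \<open>w\<close> on \<open>\<int>/N\<close>, and \<open>(f, s)\<close> acts by
  \<open>w \<mapsto> (\<lambda>x. F f x * w (x + s))\<close>.
\<close>

definition monomial_rep ::
  "((int \<Rightarrow> complex) \<Rightarrow> int \<Rightarrow> complex) \<Rightarrow> (int \<Rightarrow> complex) \<times> int \<Rightarrow> complex mat" where
  "monomial_rep F = (\<lambda>(f, s). mat N N (\<lambda>(i, j). if int j = (int i + s) mod int N then F f (int i) else 0))"

lemma monomial_rep_action:
  assumes v: "v \<in> carrier_vec N" and i: "i < N"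
  shows "(monomial_rep F (f, s) *\<^sub>v v) $ i = F f (int i) * v $ nat ((int i + s) mod int N)"
proof -
  let ?j = "nat ((int i + s) mod int N)"
  have j: "?j < N" using N_pos by (simp add: nat_less_iff)
  have "(monomial_rep F (f, s) *\<^sub>v v) $ i =
      (\<Sum>l<N. (if int l = (int i + s) mod int N then F f (int i) else 0) * v $ l)"
    using v i by (simp add: monomial_rep_def scalar_prod_def atLeast0LessThan)
  also have "\<dots> = (\<Sum>l<N. if l = ?j then F f (int i) * v $ ?j else 0)"
    using N_pos by (intro sum.cong) auto
  also have "\<dots> = F f (int i) * v $ ?j" using j by simp
  finally show ?thesis .
qed

lemma monomial_rep_trace:
  assumes "s \<in> {0..<int N}"
  shows "mat_trace (monomial_rep F (f, s)) = (if s = 0 then \<Sum>x\<in>{0..<int N}. F f x else 0)"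
proof -
  have "int i = (int i + s) mod int N \<longleftrightarrow> s = 0" if "i < N" for i
  proof
    assume "int i = (int i + s) mod int N"
    then have "(int i + s) mod int N = int i mod int N" using that by simp
    then have "int N dvd s" by (simp add: mod_eq_dvd_iff)
    then show "s = 0" using assms by (auto dest: zdvd_imp_le)
  qed (use that in simp)
  then have "mat_trace (monomial_rep F (f, s)) = (\<Sum>i<N. if s = 0 then F f (int i) else 0)"
    by (simp add: mat_trace_def monomial_rep_def cong: sum.cong_simp)
  then show ?thesis by (simp add: sum_nat_int)
qed

lemma monomial_rep_hom:
  assumes one: "\<And>x. F (\<lambda>x. 1) x = 1"
    and mult: "\<And>f g s x. F (\<lambda>x. f x * g (x + s)) x = F f x * F g (x + s)"
    and per: "\<And>f x. f \<in> base \<Longrightarrow> F f (x mod int N) = F f x"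
  shows "monomial_rep F \<in> hom wreath (GL N)"
  unfolding hom_GL_iff[OF group_wreath]
proof (intro conjI ballI)
  show "monomial_rep F g \<in> carrier_mat N N" for g
    by (cases g) (simp add: monomial_rep_def)
  show "monomial_rep F \<one>\<^bsub>wreath\<^esub> = 1\<^sub>m N"
    by (intro eq_matI) (auto simp: monomial_rep_def one_wreath one)
  fix a b assume ab: "a \<in> carrier wreath" "b \<in> carrier wreath"
  obtain f s g t where eq: "a = (f, s)" "b = (g, t)" by (metis surj_pair)
  have g: "g \<in> base" using ab eq by (simp add: carrier_wreath)
  show "monomial_rep F (a \<otimes>\<^bsub>wreath\<^esub> b) = monomial_rep F a * monomial_rep F b"
  proof (rule eq_matI)
    fix i j
    assume "i < dim_row (monomial_rep F a * monomial_rep F b)" "j < dim_col (monomial_rep F a * monomial_rep F b)"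
    then have i: "i < N" and j: "j < N" by (auto simp: monomial_rep_def eq)
    let ?k = "nat ((int i + s) mod int N)"
    have k: "int ?k = (int i + s) mod int N" "?k < N" using N_pos by (simp_all add: nat_less_iff)
    have "dim_row (monomial_rep F b) = N" by (simp add: monomial_rep_def eq)
    then have col: "col (monomial_rep F b) j \<in> carrier_vec N" by (metis col_dim)
    have "(monomial_rep F a * monomial_rep F b) $$ (i, j) = (monomial_rep F a *\<^sub>v col (monomial_rep F b) j) $ i"
      using i j by (simp add: monomial_rep_def eq)
    also have "\<dots> = F f (int i) * monomial_rep F b $$ (?k, j)"
      using monomial_rep_action[OF col i] i j k by (simp add: eq) (simp add: monomial_rep_def)
    also have "\<dots> = F f (int i) * (if int j = (int i + s + t) mod int N then F g (int i + s) else 0)"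
      using i j k by (simp add: monomial_rep_def eq per[OF g] mod_simps)
    also have "\<dots> = monomial_rep F (a \<otimes>\<^bsub>wreath\<^esub> b) $$ (i, j)"
      using i j by (simp add: monomial_rep_def eq mult_wreath mult mod_simps add.assoc)
    finally show "monomial_rep F (a \<otimes>\<^bsub>wreath\<^esub> b) $$ (i, j) = (monomial_rep F a * monomial_rep F b) $$ (i, j)" ..
  qed (auto simp: monomial_rep_def eq mult_wreath)
qed

text \<open>
  The element \<open>(\<omega>, 0)\<close> acts diagonally with pairwise distinct eigenvalues, so an invariant subspace
  contains the coordinate vectors of all coordinates that do not vanish on it. The translations
  permute the coordinate vectors transitively.
\<close>

lemma monomial_rep_irreducible:
  assumes one: "\<And>x. F (\<lambda>x. 1) x = 1"
    and mult: "\<And>f g s x. F (\<lambda>x. f x * g (x + s)) x = F f x * F g (x + s)"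
    and per: "\<And>f x. f \<in> base \<Longrightarrow> F f (x mod int N) = F f x"
    and sep: "\<And>x y. F \<omega> x = F \<omega> y \<Longrightarrow> int N dvd x - y"
  shows "irreducible_rep wreath N (monomial_rep F)"
  unfolding irreducible_rep_def
proof (intro conjI allI impI)
  show "monomial_rep F \<in> hom wreath (GL N)" by (rule monomial_rep_hom[OF one mult per])
  show "0 < N" by (rule N_pos)
  fix V assume V: "VectorSpace.subspace class_ring V (module_vec TYPE(complex) N)"
    and inv: "\<forall>g\<in>carrier wreath. \<forall>v\<in>V. monomial_rep F g *\<^sub>v v \<in> V"
  note V' = V[unfolded subspace_module_vec_iff]
  show "V = {0\<^sub>v N} \<or> V = carrier_vec N"
  proof (rule disjCI)
    assume "V \<noteq> carrier_vec N"
    show "V = {0\<^sub>v N}"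
    proof (rule ccontr)
      assume "V \<noteq> {0\<^sub>v N}"
      then obtain v where v: "v \<in> V" "v \<noteq> 0\<^sub>v N" using V' by blast
      then obtain i where i: "i < N" "v $ i \<noteq> 0"
        using V' by (metis carrier_vecD eq_vecI index_zero_vec(1) index_zero_vec(2) subsetD)
      have "\<exists>w\<in>V. w $ i \<noteq> 0 \<and> (\<forall>j\<in>J. w $ j = 0)" if "finite J" "J \<subseteq> {..<N} - {i}" for J
        using that
      proof (induction J)
        case empty
        show ?case using v i by blast
      next
        case (insert j J)
        then obtain w where w: "w \<in> V" "w $ i \<noteq> 0" "\<forall>j\<in>J. w $ j = 0" by auto
        have wc: "w \<in> carrier_vec N" using w V' by blast
        \<comment> \<open>Subtracting the eigenvalue at \<open>j\<close> kills coordinate \<open>j\<close> and rescales the others by nonzero factors.\<close>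
        let ?w = "monomial_rep F (\<omega>, 0) *\<^sub>v w + (- F \<omega> (int j)) \<cdot>\<^sub>v w"
        have "(\<omega>, 0) \<in> carrier wreath" using N_pos \<omega>_base by (simp add: carrier_wreath)
        then have "?w \<in> V" using V' inv w by blast
        moreover have comp: "?w $ l = (F \<omega> (int l) - F \<omega> (int j)) * w $ l" if "l < N" for l
          using that wc monomial_rep_action[OF wc that, of F \<omega> 0]
          by (simp add: algebra_simps)
        have "?w $ i \<noteq> 0"
        proof -
          have "\<not> int N dvd int i - int j"
          proof
            assume "int N dvd int i - int j"
            then have "int i mod int N = int j mod int N" by (simp add: mod_eq_dvd_iff)
            then show False using insert.prems i by auto
          qed
          then show ?thesis using comp[OF i(1)] w sep by force
        qed
        moreover have "?w $ l = 0" if "l \<in> insert j J" for l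
        proof -
          have "l < N" using that insert.prems by auto
          from comp[OF this] show ?thesis using w that by auto
        qed
        ultimately show ?case by blast
      qed
      from this[of "{..<N} - {i}"] obtain w where
        w: "w \<in> V" "w $ i \<noteq> 0" "\<And>j. j < N \<Longrightarrow> j \<noteq> i \<Longrightarrow> w $ j = 0" by auto
      have wc: "w \<in> carrier_vec N" using w V' by blast
      have "(1 / w $ i) \<cdot>\<^sub>v w = unit_vec N i"
      proof (rule eq_vecI)
        fix j assume "j < dim_vec (unit_vec N i :: complex vec)"
        then have j: "j < N" by simp
        then show "((1 / w $ i) \<cdot>\<^sub>v w) $ j = unit_vec N i $ j"
          using w wc i(1) by (cases "j = i") auto
      qed (use wc in simp)
      then have ei: "unit_vec N i \<in> V" using V' w by metis
      have "unit_vec N j \<in> V" if j: "j < N" for j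
      proof -
        let ?s = "(int i - int j) mod int N"
        have "((\<lambda>x. 1), ?s) \<in> carrier wreath" using N_pos base_one by (simp add: carrier_wreath)
        then have "monomial_rep F ((\<lambda>x. 1), ?s) *\<^sub>v unit_vec N i \<in> V" using inv ei by blast
        also have "monomial_rep F ((\<lambda>x. 1), ?s) *\<^sub>v unit_vec N i = unit_vec N j"
        proof (rule eq_vecI)
          fix l assume "l < dim_vec (unit_vec N j :: complex vec)"
          then have l: "l < N" by simp
          let ?k = "nat ((int l + ?s) mod int N)"
          have "?k < N" using N_pos by (simp add: nat_less_iff)
          moreover have "?k = i \<longleftrightarrow> l = j"
          proof -
            have "?k = i \<longleftrightarrow> (int l + (int i - int j)) mod int N = int i mod int N"
              using i N_pos by (subst nat_eq_iff) (auto simp: mod_simps)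
            also have "\<dots> \<longleftrightarrow> int l mod int N = int j mod int N"
              by (simp add: mod_eq_dvd_iff algebra_simps)
            finally show ?thesis using l j by simp
          qed
          ultimately show "(monomial_rep F ((\<lambda>x. 1), ?s) *\<^sub>v unit_vec N i) $ l = unit_vec N j $ l"
            using monomial_rep_action[OF unit_vec_carrier l, of F "\<lambda>x. 1" ?s i] l i j one by simp
        qed (simp add: monomial_rep_def)
        finally show ?thesis .
      qed
      then have "V = carrier_vec N" by (rule subspace_unit_vecs_eq_carrier[OF V])
      with \<open>V \<noteq> carrier_vec N\<close> show False ..
    qed
  qed
qed

section \<open>The square of the point character\<close>

definition pair_weight :: "int \<Rightarrow> (int \<Rightarrow> complex) \<Rightarrow> int \<Rightarrow> complex" where
  "pair_weight k f x = f x * f (x + k)"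

definition pair_sum :: "(int \<Rightarrow> complex) \<Rightarrow> int \<Rightarrow> complex" where
  "pair_sum f k = (\<Sum>x\<in>{0..<int N}. f x * f (x + k))"

lemma irreducible_point_rep: "irreducible_rep wreath N (monomial_rep (\<lambda>f. f))"
  by (rule monomial_rep_irreducible) (auto simp: base_mod \<omega>_eq_iff)

lemma irreducible_pair_rep: "irreducible_rep wreath N (monomial_rep (pair_weight k))"
proof (rule monomial_rep_irreducible)
  show "pair_weight k f (x mod int N) = pair_weight k f x" if "f \<in> base" for f x
  proof -
    have "f (x mod int N + k) = f (x + k)" by (rule base_cong[OF that]) (simp add: mod_simps)
    then show ?thesis by (simp add: pair_weight_def base_mod[OF that])
  qed
  fix x y assume "pair_weight k \<omega> x = pair_weight k \<omega> y"
  then have "int N dvd (x + (x + k)) - (y + (y + k))"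
    by (simp only: pair_weight_def \<omega>_add[symmetric] \<omega>_eq_iff)
  also have "(x + (x + k)) - (y + (y + k)) = 2 * (x - y)" by simp
  finally have "int N dvd 2 * (x - y)" .
  moreover have "coprime (int N) 2" using odd_N by simp
  ultimately show "int N dvd x - y" by (metis coprime_dvd_mult_right_iff)
qed (auto simp: pair_weight_def algebra_simps)

lemma pair_sum_uminus:
  assumes "f \<in> base"
  shows "pair_sum f (- k) = pair_sum f k"
proof -
  have "f (x mod int N + - k) = f (x + - k)" for x
    by (rule base_cong[OF assms]) (simp add: mod_simps)
  then have "(\<Sum>x\<in>{0..<int N}. f (x + k) * f (x + k + - k)) = (\<Sum>x\<in>{0..<int N}. f x * f (x + - k))"
    using base_mod[OF assms] by (intro sum_shift_periodic[of "\<lambda>x. f x * f (x + - k)"] N_pos) simp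
  then show ?thesis by (simp add: pair_sum_def mult.commute)
qed

text \<open>
  The twist \<open>c\<close> of \<open>f\<close> gives a factor \<open>c\<close> when \<open>k\<close> grows by \<open>p\<close>, and a factor \<open>c\<^sup>2\<close> when the
  summation variable is translated by \<open>p\<close>. The latter changes nothing, so either the pair sum is
  zero or \<open>c\<^sup>2 = 1\<close>, and then \<open>c = 1\<close> because \<open>c ^ q = 1\<close> with \<open>q\<close> odd.
\<close>

lemma pair_sum_add_p:
  assumes f: "f \<in> base"
  shows "pair_sum f (k + int p) = pair_sum f k"
proof -
  obtain c where c: "c ^ q = 1" "\<And>x. f (x + int p) = c * f x"
    using f by (auto simp: base_def)
  have "f (x + (k + int p)) = c * f (x + k)" for x
    using c(2)[of "x + k"] by (simp add: add.assoc)
  then have 1: "pair_sum f (k + int p) = c * pair_sum f k"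
    by (simp add: pair_sum_def sum_distrib_left mult.left_commute)
  have "f (x mod int N + k) = f (x + k)" for x
    by (rule base_cong[OF f]) (simp add: mod_simps)
  then have "(\<Sum>x\<in>{0..<int N}. f (x + int p) * f (x + int p + k)) = pair_sum f k"
    unfolding pair_sum_def
    using base_mod[OF f] by (intro sum_shift_periodic[of "\<lambda>x. f x * f (x + k)"] N_pos) simp
  moreover have "f (x + int p) * f (x + int p + k) = c\<^sup>2 * (f x * f (x + k))" for x
    using c(2)[of x] c(2)[of "x + k"] by (simp add: power2_eq_square algebra_simps)
  ultimately have 2: "c\<^sup>2 * pair_sum f k = pair_sum f k"
    by (simp add: pair_sum_def sum_distrib_left)
  show ?thesis
  proof (cases "pair_sum f k = 0")
    case False
    with 2 have "c\<^sup>2 = 1" by simp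
    obtain r where "q = 2 * r + 1" using odd_q by (elim oddE)
    then have "c ^ q = (c\<^sup>2) ^ r * c" by (simp add: power_mult)
    then have "c = 1" using c \<open>c\<^sup>2 = 1\<close> by simp
    then show ?thesis using 1 by simp
  qed (use 1 in simp)
qed

lemma pair_sum_add_mult_p: "f \<in> base \<Longrightarrow> pair_sum f (k + int (j * p)) = pair_sum f k"
proof (induction j)
  case (Suc j)
  have "k + int (Suc j * p) = (k + int (j * p)) + int p" by (simp add: algebra_simps)
  then show ?case using Suc pair_sum_add_p[OF Suc.prems, of "k + int (j * p)"] by metis
qed simp

text \<open>
  The square is the sum of the pair sums over all differences \<open>t\<close> modulo \<open>N\<close>. They depend only on
  \<open>t\<close> modulo \<open>p\<close>, so each class counts \<open>q\<close> times, and the classes of \<open>t\<close> and \<open>- t\<close> agree.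
\<close>

lemma square_sum_eq_pair_sums:
  assumes f: "f \<in> base"
  shows "(\<Sum>x\<in>{0..<int N}. f x)\<^sup>2 =
    (\<Sum>k\<le>(p - 1) div 2. of_nat (if k = 0 then q else 2 * q) * pair_sum f (int k))"
proof -
  define h where "h = (p - 1) div 2"
  have p: "p = 2 * h + 1" using odd_p p_gt_2 by (auto simp: h_def elim!: oddE)
  have "(\<Sum>x\<in>{0..<int N}. f x)\<^sup>2 = (\<Sum>x\<in>{0..<int N}. f x * (\<Sum>t\<in>{0..<int N}. f (t + x)))"
    unfolding power2_eq_square sum_distrib_right
    using sum_shift_periodic[of f N, OF base_mod[OF f] N_pos] by simp
  also have "\<dots> = (\<Sum>t\<in>{0..<int N}. pair_sum f t)"
    unfolding pair_sum_def sum_distrib_left by (subst sum.swap) (simp add: add.commute)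
  also have "\<dots> = (\<Sum>t<N. pair_sum f (int t))" by (rule sum_nat_int[symmetric])
  also have "\<dots> = (\<Sum>j<q. \<Sum>t\<in>{j * p..<j * p + p}. pair_sum f (int t))"
    by (simp add: sum.nat_group N_eq mult.commute)
  also have "\<dots> = (\<Sum>j<q. \<Sum>t<p. pair_sum f (int t))"
  proof (rule sum.cong)
    fix j
    have "(\<Sum>t\<in>{j * p..<j * p + p}. pair_sum f (int t)) = (\<Sum>t<p. pair_sum f (int t + int (j * p)))"
      by (rule sum.reindex_bij_witness[of _ "\<lambda>t. t + j * p" "\<lambda>t. t - j * p"]) auto
    then show "(\<Sum>t\<in>{j * p..<j * p + p}. pair_sum f (int t)) = (\<Sum>t<p. pair_sum f (int t))"
      using pair_sum_add_mult_p[OF f] by simp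
  qed simp
  also have "\<dots> = of_nat q * (\<Sum>t<p. pair_sum f (int t))" by simp
  also have "(\<Sum>t<p. pair_sum f (int t)) =
      pair_sum f 0 + (\<Sum>t\<in>{1..h}. pair_sum f (int t)) + (\<Sum>t\<in>{h+1..2*h}. pair_sum f (int t))"
  proof -
    have "{..<p} = {0} \<union> {1..h} \<union> {h+1..2*h}" using p by auto
    then show ?thesis by (subst (1) \<open>{..<p} = _\<close>) (subst sum.union_disjoint, auto)+
  qed
  also have "(\<Sum>t\<in>{h+1..2*h}. pair_sum f (int t)) = (\<Sum>t\<in>{1..h}. pair_sum f (int t))"
  proof (rule sum.reindex_bij_witness[of _ "\<lambda>t. p - t" "\<lambda>t. p - t"])
    fix t assume t: "t \<in> {h + 1..2 * h}"
    then have "int (p - t) = - int t + int p" using p by auto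
    then show "pair_sum f (int (p - t)) = pair_sum f (int t)"
      using pair_sum_add_p[OF f, of "- int t"] pair_sum_uminus[OF f, of "int t"] by simp
  qed (use p in auto)
  also have "of_nat q * (pair_sum f 0 + (\<Sum>t\<in>{1..h}. pair_sum f (int t)) + (\<Sum>t\<in>{1..h}. pair_sum f (int t))) =
      of_nat q * pair_sum f 0 + (\<Sum>t\<in>{1..h}. of_nat (2 * q) * pair_sum f (int t))"
    by (simp add: algebra_simps sum_distrib_left[symmetric])
  also have "\<dots> = (\<Sum>k\<in>insert 0 {1..h}. of_nat (if k = 0 then q else 2 * q) * pair_sum f (int k))"
    by (subst sum.insert) (auto intro!: sum.cong)
  also have "insert 0 {1..h} = {..h}" by auto
  finally show ?thesis by (simp add: h_def)
qed

section \<open>Test functions\<close>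

definition step :: "int set \<Rightarrow> int \<Rightarrow> complex" where
  "step B x = (if x mod int p \<in> B then \<omega> 1 else 1)"

lemma \<omega>_1_neq_1: "\<omega> 1 \<noteq> 1"
proof -
  have "p * 1 \<le> p * q" using q_pos by (intro mult_le_mono2) simp
  then have "N > 1" unfolding N_eq using p_gt_2 by linarith
  then show ?thesis by (auto simp: \<omega>_eq_1_iff dest: zdvd_imp_le)
qed

lemma step_base: "step B \<in> base"
  using \<omega>_base by (intro baseI[where c = 1]) (auto simp: step_def base_def)

text \<open>
  With \<open>b\<close> the indicator function of \<open>B\<close> modulo \<open>p\<close> and \<open>z = \<omega> 1 - 1\<close>, the test function is
  \<open>1 + z * b\<close>. In the expanded product only the coefficient of \<open>z\<^sup>2\<close> depends on the difference \<open>k\<close>.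
\<close>

lemma pair_sum_step_eq_iff:
  "pair_sum (step B) k = pair_sum (step B) l \<longleftrightarrow>
    card {x \<in> {0..<int N}. x mod int p \<in> B \<and> (x + k) mod int p \<in> B} =
    card {x \<in> {0..<int N}. x mod int p \<in> B \<and> (x + l) mod int p \<in> B}"
proof -
  let ?z = "\<omega> 1 - 1"
  define b where "b x = (if x mod int p \<in> B then 1 else 0 :: complex)" for x
  let ?C = "\<lambda>k. card {x \<in> {0..<int N}. x mod int p \<in> B \<and> (x + k) mod int p \<in> B}"
  have stepb: "step B x = 1 + ?z * b x" for x by (simp add: step_def b_def)
  have pN: "int p dvd int N" by (simp add: N_eq)
  have shift: "(\<Sum>x\<in>{0..<int N}. b (x + k)) = (\<Sum>x\<in>{0..<int N}. b x)" for k
    by (rule sum_shift_periodic[OF _ N_pos]) (simp add: b_def mod_mod_cancel[OF pN])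
  have cnt: "(\<Sum>x\<in>{0..<int N}. b x * b (x + k)) = of_nat (?C k)" for k
  proof -
    have "(\<Sum>x\<in>{0..<int N}. b x * b (x + k)) =
        (\<Sum>x\<in>{0..<int N}. if x mod int p \<in> B \<and> (x + k) mod int p \<in> B then 1 else 0)"
      by (intro sum.cong) (auto simp: b_def)
    then show ?thesis by (simp add: sum.If_cases Int_def)
  qed
  have "pair_sum (step B) k = of_nat N + 2 * ?z * (\<Sum>x\<in>{0..<int N}. b x) + ?z\<^sup>2 * of_nat (?C k)" for k
  proof -
    have "step B x * step B (x + k) = 1 + ?z * b x + ?z * b (x + k) + ?z\<^sup>2 * (b x * b (x + k))" for x
      by (simp add: stepb power2_eq_square algebra_simps)
    then have "pair_sum (step B) k = of_nat N + ?z * (\<Sum>x\<in>{0..<int N}. b x) +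
        ?z * (\<Sum>x\<in>{0..<int N}. b (x + k)) + ?z\<^sup>2 * (\<Sum>x\<in>{0..<int N}. b x * b (x + k))"
      by (simp add: pair_sum_def sum.distrib sum_distrib_left)
    then show ?thesis by (simp add: shift cnt)
  qed
  then show ?thesis using \<omega>_1_neq_1 by simp
qed

text \<open>
  The residues \<open>0\<close> and \<open>k\<close> differ by \<open>k\<close>, while no two residues in \<open>{0, k}\<close> differ by \<open>l\<close>: this uses
  \<open>k < l\<close> and \<open>k + l < p\<close>.
\<close>

lemma pair_sum_step_distinct:
  assumes "k < l" and "l \<le> (p - 1) div 2"
  shows "pair_sum (step {0, int k}) (int k) \<noteq> pair_sum (step {0, int k}) (int l)"
proof -
  have lp: "k + l < p" "0 < l" using assms p_gt_2 by auto
  define S where "S t = {x \<in> {0..<int N}. x mod int p \<in> {0, int k} \<and> (x + int t) mod int p \<in> {0, int k}}"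
    for t
  have "0 \<in> S k" using N_pos lp by (auto simp: S_def)
  moreover have "finite (S k)" unfolding S_def by (rule finite_subset[of _ "{0..<int N}"]) auto
  ultimately have "card (S k) \<noteq> 0" by (metis card_0_eq empty_iff)
  moreover have "S l = {}"
  proof -
    have no: "(x + int l) mod int p \<notin> {0, int k}" if x: "x mod int p \<in> {0, int k}" for x
    proof -
      have "(x + int l) mod int p = (x mod int p + int l) mod int p" by (simp only: mod_add_left_eq)
      also have "\<dots> = x mod int p + int l" using x lp by (intro mod_pos_pos_trivial) auto
      finally show ?thesis using x lp assms by auto
    qed
    show ?thesis
    proof (rule equals0I)
      fix x assume "x \<in> S l"
      then have "x mod int p \<in> {0, int k}" "(x + int l) mod int p \<in> {0, int k}"
        unfolding S_def by auto
      with no show False by metis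
    qed
  qed
  ultimately have "card (S k) \<noteq> card (S l)" by simp
  then show ?thesis unfolding pair_sum_step_eq_iff S_def .
qed

text \<open>
  If \<open>b\<close> values equal \<open>\<omega> 1\<close> and \<open>N - b\<close> values equal \<open>1\<close>, a zero sum forces \<open>b = N - b\<close> by
  comparing absolute values, but \<open>N\<close> is odd.
\<close>

lemma sum_step_nonzero: "(\<Sum>x\<in>{0..<int N}. step B x) \<noteq> 0"
proof
  let ?S = "{x \<in> {0..<int N}. x mod int p \<in> B}"
  define b where "b = card ?S"
  assume 0: "(\<Sum>x\<in>{0..<int N}. step B x) = 0"
  have "(\<Sum>x\<in>{0..<int N}. step B x) = (\<Sum>x\<in>{0..<int N}. 1 + (\<omega> 1 - 1) * (if x mod int p \<in> B then 1 else 0))"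
    by (intro sum.cong) (auto simp: step_def)
  also have "\<dots> = of_nat N + (\<omega> 1 - 1) * of_nat b"
    by (simp add: sum.distrib sum_distrib_left[symmetric] sum.If_cases Int_def b_def)
  finally have eq: "\<omega> 1 * of_nat b = of_nat b - of_nat N"
    using 0 by (simp add: algebra_simps)
  have "b \<le> card {0..<int N}" unfolding b_def by (intro card_mono) auto
  then have "b \<le> N" by simp
  have "norm (\<omega> 1 * of_nat b) = real b" by (simp add: norm_mult \<omega>_def)
  moreover have "of_nat b - of_nat N = - (of_nat (N - b) :: complex)"
    using \<open>b \<le> N\<close> by (simp add: of_nat_diff)
  then have "norm (of_nat b - of_nat N :: complex) = real (N - b)"
    by (metis norm_minus_cancel norm_of_nat)
  ultimately have "b = N - b" using eq by simp
  then have "N = 2 * b" using \<open>b \<le> N\<close> by simp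
  then show False using odd_N by simp
qed

text \<open>
  A sum of \<open>N\<close> numbers of absolute value \<open>1\<close> equals \<open>N\<close> only if each of them is \<open>1\<close>.
\<close>

lemma sum_base_eq_N:
  assumes f: "f \<in> base" and sum: "(\<Sum>x\<in>{0..<int N}. f x) = of_nat N"
  shows "f = (\<lambda>x. 1)"
proof
  fix y
  have norm: "norm (f x) = 1" for x
    using f N_pos power_eq_1_iff[of "f x" N] by (auto simp: base_def)
  have le: "Re (f x) \<le> 1" for x using complex_Re_le_cmod[of "f x"] norm by simp
  have "(\<Sum>x\<in>{0..<int N}. 1 - Re (f x)) = 0"
    using arg_cong[OF sum, of Re] by (simp add: sum_subtractf)
  then have "\<forall>x\<in>{0..<int N}. 1 - Re (f x) = 0"
    using le by (subst (asm) sum_nonneg_eq_0_iff) auto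
  then have "Re (f (y mod int N)) = 1" using N_pos by auto
  then have Re: "Re (f y) = 1" using base_mod[OF f] by simp
  then have "Im (f y) = 0" using norm[of y] by (simp add: cmod_def)
  with Re show "f y = 1" by (simp add: complex_eq_iff)
qed

section \<open>Characters of the twisted wreath product\<close>

lemma char_point:
  assumes "(f, s) \<in> carrier wreath"
  shows "mat_trace (monomial_rep (\<lambda>f. f) (f, s)) = (if s = 0 then \<Sum>x\<in>{0..<int N}. f x else 0)"
  using assms by (intro monomial_rep_trace) (simp add: carrier_wreath)

lemma char_pair:
  assumes "(f, s) \<in> carrier wreath"
  shows "mat_trace (monomial_rep (pair_weight k) (f, s)) = (if s = 0 then pair_sum f k else 0)"
  using assms monomial_rep_trace[of s "pair_weight k" f]
  by (simp add: carrier_wreath pair_sum_def pair_weight_def)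

lemma faithful_point:
  assumes "g \<in> carrier wreath" and "mat_trace (monomial_rep (\<lambda>f. f) g) = of_nat N"
  shows "g = \<one>\<^bsub>wreath\<^esub>"
proof (cases g)
  case (Pair f s)
  then show ?thesis
    using assms char_point[of f s] sum_base_eq_N[of f] N_pos by (auto simp: carrier_wreath one_wreath split: if_splits)
qed

lemma nonvanishing_noncentral:
  "\<exists>g\<in>carrier wreath - group_center wreath. mat_trace (monomial_rep (\<lambda>f. f) g) \<noteq> 0"
proof
  let ?g = "(step {0}, 0) :: (int \<Rightarrow> complex) \<times> int"
  have N1: "N > 1" using \<omega>_1_neq_1 N_pos by (cases "N = 1") (auto simp: \<omega>_eq_1_iff)
  have g: "?g \<in> carrier wreath" using step_base N_pos by (simp add: carrier_wreath)
  show "mat_trace (monomial_rep (\<lambda>f. f) ?g) \<noteq> 0"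
    using sum_step_nonzero by (simp add: char_point[OF g])
  have t: "((\<lambda>x. 1), 1) \<in> carrier wreath" using base_one N1 by (simp add: carrier_wreath)
  \<comment> \<open>The test function is not invariant under translation by \<open>1\<close>.\<close>
  have "?g \<otimes>\<^bsub>wreath\<^esub> ((\<lambda>x. 1), 1) \<noteq> ((\<lambda>x. 1), 1) \<otimes>\<^bsub>wreath\<^esub> ?g"
  proof
    assume "?g \<otimes>\<^bsub>wreath\<^esub> ((\<lambda>x. 1), 1) = ((\<lambda>x. 1), 1) \<otimes>\<^bsub>wreath\<^esub> ?g"
    then have "step {0} 0 = step {0} 1" by (simp add: mult_wreath fun_eq_iff) (metis add_0)
    then show False using p_gt_2 \<omega>_1_neq_1 by (simp add: step_def)
  qed
  then show "?g \<in> carrier wreath - group_center wreath" using g t by (auto simp: group_center_def)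
qed

end

section \<open>Characters whose square has (p + 1) / 2 irreducible constituents\<close>

theorem proposition6p1:
  fixes p m :: nat
  assumes "prime p" and "odd p" and "m \<ge> 1"
  shows "\<exists>(G :: nat monoid) \<chi>.
           finite_p_group p G \<and>
           \<chi> \<in> Irr G \<and>
           faithful_char G \<chi> \<and>
           card (irr_constituents G (\<lambda>g. \<chi> g * \<chi> g)) = (p + 1) div 2 \<and>
           (\<exists>g \<in> carrier G - group_center G. \<chi> g \<noteq> 0) \<and>
           \<chi> \<one>\<^bsub>G\<^esub> = of_nat (p ^ m)"
proof -
  interpret odd_prime_power p m using assms by unfold_locales
  interpret wreath: group wreath by (rule group_wreath)
  obtain G :: "nat monoid" and h where G: "group G" and iso: "h \<in> iso G wreath"
    using finite_group_iso_nat[OF group_wreath finite_wreath] by blast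
  interpret G: group G by fact
  have hom: "h \<in> hom G wreath" and bij: "bij_betw h (carrier G) (carrier wreath)"
    using iso by (auto simp: iso_def)
  have h_in: "h g \<in> carrier wreath" if "g \<in> carrier G" for g using bij that by (auto simp: bij_betw_def)
  have h_surj: "\<exists>g\<in>carrier G. h g = w" if "w \<in> carrier wreath" for w
    using bij that by (metis bij_betw_imp_surj_on imageE)
  have finG: "finite (carrier G)" using bij finite_wreath by (simp add: bij_betw_finite)
  have h_one: "h \<one>\<^bsub>G\<^esub> = \<one>\<^bsub>wreath\<^esub>" by (rule hom_one[OF hom G group_wreath])
  define \<chi> where "\<chi> = rep_character G (monomial_rep (\<lambda>f. f) \<circ> h)"
  define X where "X k = rep_character G (monomial_rep (pair_weight (int k)) \<circ> h)" for k
  have \<chi>: "\<chi> g = mat_trace (monomial_rep (\<lambda>f. f) (h g))" if "g \<in> carrier G" for g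
    using that by (simp add: \<chi>_def rep_character_def)
  have X: "X k g = mat_trace (monomial_rep (pair_weight (int k)) (h g))" if "g \<in> carrier G" for k g
    using that by (simp add: X_def rep_character_def)
  have irr\<chi>: "\<chi> \<in> Irr G"
    using irreducible_rep_pullback[OF G group_wreath iso irreducible_point_rep] by (auto simp: Irr_def \<chi>_def)
  have irrX: "X k \<in> Irr G" for k
    using irreducible_rep_pullback[OF G group_wreath iso irreducible_pair_rep] by (auto simp: Irr_def X_def)
  have deg: "\<chi> \<one>\<^bsub>G\<^esub> = of_nat N"
    using char_point[of "\<lambda>x. 1" 0] wreath.one_closed by (simp add: \<chi> h_one one_wreath)
  have "finite_p_group p G"
    using order_wreath bij_betw_same_card[OF bij] finG G by (simp add: finite_p_group_def Coset.order_def)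
  moreover have "faithful_char G \<chi>"
  proof -
    have "g = \<one>\<^bsub>G\<^esub>" if g: "g \<in> carrier G" "\<chi> g = \<chi> \<one>\<^bsub>G\<^esub>" for g
    proof -
      have "h g = h \<one>\<^bsub>G\<^esub>"
        using faithful_point[OF h_in[OF g(1)]] g deg by (simp add: \<chi> h_one)
      then show ?thesis using bij g by (auto simp: bij_betw_def inj_on_def)
    qed
    then show ?thesis by (auto simp: faithful_char_def char_kernel_def)
  qed
  moreover have "card (irr_constituents G (\<lambda>g. \<chi> g * \<chi> g)) = (p + 1) div 2"
  proof -
    let ?I = "{..(p - 1) div 2}"
    have inj: "inj_on X ?I"
    proof (rule linorder_inj_onI)
      fix k l assume kl: "k < l" "l \<in> ?I"
      let ?f = "step {0, int k}"
      have f: "(?f, 0) \<in> carrier wreath" using step_base N_pos by (simp add: carrier_wreath)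
      then obtain g where g: "g \<in> carrier G" "h g = (?f, 0)" using h_surj by metis
      have "X k g \<noteq> X l g"
        using pair_sum_step_distinct[of k l] kl f g by (simp add: X char_pair)
      then show "X k \<noteq> X l" by metis
    qed auto
    have "card (irr_constituents G (\<lambda>g. \<chi> g * \<chi> g)) = card ?I"
    proof (rule card_irr_constituents[OF G finG _ irrX inj])
      show "(if k = 0 then q else 2 * q) \<noteq> 0" for k :: nat using q_pos by simp
      fix g assume g: "g \<in> carrier G"
      obtain f s where fs: "h g = (f, s)" by (metis surj_pair)
      have wreath: "(f, s) \<in> carrier wreath" using h_in[OF g] fs by simp
      then have "f \<in> base" by (simp add: carrier_wreath)
      then show "\<chi> g * \<chi> g = (\<Sum>k\<in>?I. of_nat (if k = 0 then q else 2 * q) * X k g)"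
        using square_sum_eq_pair_sums[of f]
        by (simp add: \<chi>[OF g] X[OF g] fs char_point[OF wreath] char_pair[OF wreath] power2_eq_square)
    qed simp
    also have "card ?I = (p + 1) div 2" using odd_p p_gt_2 by (auto elim!: oddE)
    finally show ?thesis .
  qed
  moreover have "\<exists>g \<in> carrier G - group_center G. \<chi> g \<noteq> 0"
  proof -
    obtain w where w: "w \<in> carrier wreath" "w \<notin> group_center wreath" "mat_trace (monomial_rep (\<lambda>f. f) w) \<noteq> 0"
      using nonvanishing_noncentral by blast
    then obtain g where g: "g \<in> carrier G" "h g = w" using h_surj by metis
    have "g \<notin> group_center G"
    proof
      assume c: "g \<in> group_center G"
      have "w \<otimes>\<^bsub>wreath\<^esub> v = v \<otimes>\<^bsub>wreath\<^esub> w" if v: "v \<in> carrier wreath" for v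
      proof -
        obtain v' where v': "v' \<in> carrier G" "h v' = v" using h_surj[OF v] by metis
        then have "g \<otimes>\<^bsub>G\<^esub> v' = v' \<otimes>\<^bsub>G\<^esub> g" using c by (simp add: group_center_def)
        then have "h g \<otimes>\<^bsub>wreath\<^esub> h v' = h v' \<otimes>\<^bsub>wreath\<^esub> h g"
          using hom_mult[OF hom g(1) v'(1)] hom_mult[OF hom v'(1) g(1)] by simp
        then show ?thesis using g v' by simp
      qed
      then show False using w by (auto simp: group_center_def)
    qed
    with g w \<chi> show ?thesis by auto
  qed
  ultimately show ?thesis using irr\<chi> deg by (auto simp: N_def)
qed

end
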